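(* Let $k>1$ be real, $d>0$ and $a\in(0,1)$. Let $g_{\mathrm{MK}}(u;a)=-u$ for $u<a$ and $g_{\mathrm{MK}}(u;a)=1-u$ for $u\ge a$. Consider the system $$\dot u_i=d\big(ku_{i+1}-(k+1)u_i+u_{i-1}\big)+g_{\mathrm{MK}}(u_i;a),\qquad i\in\mathbb Z,\ t>0,$$ and put $$a_\pm(d,k)=\frac12\left(1+\frac{(k-1)d\pm1}{\sqrt{(1+d(k+1))^2-4d^2k}}\right).$$ Then there exists a pinned monotone wave of this system if and only if $$a_-(d,k)<a\le a_+(d,k).$$ Moreover, the pinned monotone waves are stable.
   Context: A pinned monotone wave is a stationary (time-independent) solution of the system, i.e. a real sequence $(u_i)_{i\in\mathbb Z}$ with $$0=d\big(ku_{i+1}-(k+1)u_i+u_{i-1}\big)+g_{\mathrm{MK}}(u_i;a)\quad\text{for all } i\in\mathbb Z,$$ which is increasing in $i$ and satisfies $u_i\to0$ as $i\to-\infty$ and $u_i\to1$ as $i\to+\infty$. Stability of a stationary solution $(u_i)$ is understood in the usual sense with respect to the supremum norm: for every $\varepsilon>0$ there is $\delta>0$ such that every solution $(\tilde u_i(t))_{i\in\mathbb Z}$ of the system, bounded in $i$, with $\sup_i|\tilde u_i(0)-u_i|<\delta$ satisfies $\sup_i|\tilde u_i(t)-u_i|<\varepsilon$ for all $t\ge0$.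
   Formalization: Stability of the pinned monotone waves is asserted only for a ≠ a_+(d,k): at a = a_+(d,k) the wave takes the value a exactly, and lowering that entry slightly yields a solution that leaves the wave, so stability fails there. *)

theory Defs
  imports "HOL-Analysis.Analysis"
begin

definition g_MK :: "real \<Rightarrow> real \<Rightarrow> real" where
  "g_MK u a = (if u < a then - u else 1 - u)"

definition lattice_rhs :: "real \<Rightarrow> real \<Rightarrow> real \<Rightarrow> (int \<Rightarrow> real) \<Rightarrow> int \<Rightarrow> real" where
  "lattice_rhs d k a u i =
     d * (k * u (i + 1) - (k + 1) * u i + u (i - 1)) + g_MK (u i) a"

definition a_minus :: "real \<Rightarrow> real \<Rightarrow> real" where
  "a_minus d k =
     1 / 2 * (1 + ((k - 1) * d - 1) / sqrt ((1 + d * (k + 1))\<^sup>2 - 4 * d\<^sup>2 * k))"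

definition a_plus :: "real \<Rightarrow> real \<Rightarrow> real" where
  "a_plus d k =
     1 / 2 * (1 + ((k - 1) * d + 1) / sqrt ((1 + d * (k + 1))\<^sup>2 - 4 * d\<^sup>2 * k))"

definition pinned_monotone_wave :: "real \<Rightarrow> real \<Rightarrow> real \<Rightarrow> (int \<Rightarrow> real) \<Rightarrow> bool" where
  "pinned_monotone_wave d k a u \<longleftrightarrow>
     (\<forall>i. 0 = lattice_rhs d k a u i) \<and> mono u \<and>
     (u \<longlongrightarrow> 0) at_bot \<and> (u \<longlongrightarrow> 1) at_top"

text \<open>
  Since the nonlinearity jumps, a solution that crosses the level \<open>a\<close> has no classical derivative
  at the crossing time.  Solutions are therefore understood in the sense of Caratheodory, i.e. they
  satisfy the integrated equation in every component.  Classical solutions are included, see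
  \<open>classical_lattice_solution\<close> below.  The argument order is \<open>v t i\<close>; only times \<open>t \<ge> 0\<close> matter.
\<close>

definition lattice_solution ::
  "real \<Rightarrow> real \<Rightarrow> real \<Rightarrow> (real \<Rightarrow> int \<Rightarrow> real) \<Rightarrow> bool" where
  "lattice_solution d k a v \<longleftrightarrow>
     (\<forall>i. \<forall>t\<ge>0. ((\<lambda>s. lattice_rhs d k a (v s) i) has_integral (v t i - v 0 i)) {0..t})"

text \<open>
  The suprema below are suprema of bounded sets whenever \<open>u\<close> is bounded, in particular for every
  pinned monotone wave.
\<close>

definition wave_stable :: "real \<Rightarrow> real \<Rightarrow> real \<Rightarrow> (int \<Rightarrow> real) \<Rightarrow> bool" where
  "wave_stable d k a u \<longleftrightarrow>
     (\<forall>\<epsilon>>0. \<exists>\<delta>>0. \<forall>v. lattice_solution d k a v \<longrightarrow>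
        (\<forall>t\<ge>0. bounded (range (v t))) \<longrightarrow>
        (SUP i. \<bar>v 0 i - u i\<bar>) < \<delta> \<longrightarrow>
        (\<forall>t\<ge>0. (SUP i. \<bar>v t i - u i\<bar>) < \<epsilon>))"

lemma classical_lattice_solution:
  assumes "\<And>i. continuous_on {0..} (\<lambda>t. v t i)"
    and "\<And>i t. t > 0 \<Longrightarrow> ((\<lambda>t. v t i) has_real_derivative lattice_rhs d k a (v t) i) (at t)"
  shows "lattice_solution d k a v"
  unfolding lattice_solution_def
proof (intro allI impI)
  fix i :: int and t :: real assume "t \<ge> 0"
  then show "((\<lambda>s. lattice_rhs d k a (v s) i) has_integral v t i - v 0 i) {0..t}"
    by (intro fundamental_theorem_of_calculus_interior)
      (auto intro: continuous_on_subset[OF assms(1)] assms(2)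
        simp: has_real_derivative_iff_has_vector_derivative[symmetric])
qed

lemma pinned_monotone_wave_range:
  assumes "pinned_monotone_wave d k a u"
  shows "0 \<le> u i" "u i \<le> 1"
proof -
  have m: "mono u" and l: "(u \<longlongrightarrow> 0) at_bot" "(u \<longlongrightarrow> 1) at_top"
    using assms by (auto simp: pinned_monotone_wave_def)
  show "0 \<le> u i"
    by (rule tendsto_upperbound[OF l(1)])
      (auto intro!: eventually_mono[OF eventually_le_at_bot[of i]] monoD[OF m])
  show "u i \<le> 1"
    by (rule tendsto_lowerbound[OF l(2)])
      (auto intro!: eventually_mono[OF eventually_ge_at_top[of i]] monoD[OF m])
qed

text \<open>It makes no difference whether "increasing" is read strictly or not.\<close>

lemma pinned_monotone_wave_strict_mono:
  assumes "k > 1" "d > 0" and w: "pinned_monotone_wave d k a u"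
  shows "strict_mono u"
proof -
  have m: "mono u" and l: "(u \<longlongrightarrow> 0) at_bot" "(u \<longlongrightarrow> 1) at_top"
    and eq: "\<And>i. 0 = lattice_rhs d k a u i"
    using w by (auto simp: pinned_monotone_wave_def)
  have nb: "u (i + 1) = u (i + 1 + 1) \<and> u (i - 1) = u i" if h: "u i = u (i + 1)" for i
  proof -
    have s: "u (i - 1) \<le> u i" "u (i + 1) \<le> u (i + 1 + 1)" by (auto intro: monoD[OF m])
    have "d * (k * u (i + 1) - (k + 1) * u i + u (i - 1)) =
          d * (k * u (i + 1 + 1) - (k + 1) * u (i + 1) + u i)"
      using eq[of i] eq[of "i + 1"] h unfolding lattice_rhs_def by (smt (verit) add_diff_cancel_right')
    then have "k * u (i + 1) - (k + 1) * u i + u (i - 1) =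
               k * u (i + 1 + 1) - (k + 1) * u (i + 1) + u i"
      using \<open>d > 0\<close> by simp
    then have e: "k * (u (i + 1 + 1) - u (i + 1)) + (u i - u (i - 1)) = 0"
      using h by (simp add: algebra_simps)
    have p: "k * (u (i + 1 + 1) - u (i + 1)) \<ge> 0" using s \<open>k > 1\<close> by simp
    then have z: "u i - u (i - 1) = 0" using e s by linarith
    then have "k * (u (i + 1 + 1) - u (i + 1)) = 0" using e by linarith
    then show ?thesis using z \<open>k > 1\<close> by simp
  qed
  have ne: "u i \<noteq> u (i + 1)" for i
  proof
    assume h: "u i = u (i + 1)"
    have up: "u j = u i \<and> u (j + 1) = u i" if "j \<ge> i" for j
      using that by (induction rule: int_ge_induct) (use h nb in force)+
    have dn: "u j = u i \<and> u (j + 1) = u i" if "j \<le> i" for j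
      using that by (induction rule: int_le_induct) (use h nb in force)+
    have c: "u = (\<lambda>_. u i)" using up dn by (metis linorder_linear)
    have "u i = 0" using l(1) c by (metis tendsto_const_iff trivial_limit_at_bot_linorder)
    moreover have "u i = 1" using l(2) c by (metis tendsto_const_iff trivial_limit_at_top_linorder)
    ultimately show False by simp
  qed
  show ?thesis
  proof (rule strict_monoI)
    fix x y :: int assume "x < y"
    then have "u (x + 1) \<le> u y" by (intro monoD[OF m]) simp
    moreover have "u x < u (x + 1)" using ne[of x] monoD[OF m, of x "x + 1"] by simp
    ultimately show "u x < u y" by simp
  qed
qed

text \<open>
  Stability fails at the endpoint \<open>a = a_plus d k\<close>, so a stability assertion for pinned waves must
  exclude this value although pinned waves exist there
  (\<open>pinned_monotone_wave_unstable_at_a_plus\<close> below).  The wave then satisfies \<open>u 0 = a\<close>; lowering this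
  single entry by an arbitrarily small amount switches the nonlinearity at that site, and a
  classical solution moves away towards the wave shifted by one site.  The solution is built from
  the exponential series of the operator \<open>x \<mapsto> d * (k * x (i + 1) + x (i - 1))\<close>.
\<close>

definition nbr :: "real \<Rightarrow> real \<Rightarrow> (int \<Rightarrow> real) \<Rightarrow> int \<Rightarrow> real" where
  "nbr d k x i = d * (k * x (i + 1) + x (i - 1))"

definition nbr_exp :: "real \<Rightarrow> real \<Rightarrow> (int \<Rightarrow> real) \<Rightarrow> int \<Rightarrow> real \<Rightarrow> real" where
  "nbr_exp d k x i t = (\<Sum>n. ((nbr d k ^^ n) x i / fact n) * t ^ n)"

lemma nbr_funpow_bound:
  assumes "k > 1" "d > 0" "\<And>i. \<bar>x i\<bar> \<le> M"
  shows "\<bar>(nbr d k ^^ n) x i\<bar> \<le> (d * (k + 1)) ^ n * M"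
proof (induction n arbitrary: i)
  case 0
  then show ?case using assms by simp
next
  case (Suc n)
  let ?y = "(nbr d k ^^ n) x" and ?b = "(d * (k + 1)) ^ n * M"
  have "\<bar>k * ?y (i + 1) + ?y (i - 1)\<bar> \<le> k * \<bar>?y (i + 1)\<bar> + \<bar>?y (i - 1)\<bar>"
    using assms(1) abs_triangle_ineq[of "k * ?y (i + 1)" "?y (i - 1)"] by (simp add: abs_mult)
  also have "\<dots> \<le> k * ?b + ?b"
    using Suc.IH assms(1) by (intro add_mono mult_left_mono) auto
  finally have "d * \<bar>k * ?y (i + 1) + ?y (i - 1)\<bar> \<le> d * (k * ?b + ?b)"
    using assms(2) by simp
  moreover have "(nbr d k ^^ Suc n) x i = d * (k * ?y (i + 1) + ?y (i - 1))"
    using nbr_def[of d k ?y i] by simp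
  ultimately show ?case using assms(2) by (simp only: abs_mult) (simp add: algebra_simps)
qed

lemma nbr_exp_summable:
  assumes "k > 1" "d > 0" "\<And>i. \<bar>x i\<bar> \<le> M"
  shows "summable (\<lambda>n. ((nbr d k ^^ n) x i / fact n) * (t::real) ^ n)"
proof (rule summable_comparison_test')
  show "summable (\<lambda>n. M * (inverse (fact n) * (d * (k + 1) * \<bar>t\<bar>) ^ n))"
    by (intro summable_mult summable_exp)
  show "norm (((nbr d k ^^ n) x i / fact n) * t ^ n)
          \<le> M * (inverse (fact n) * (d * (k + 1) * \<bar>t\<bar>) ^ n)" for n
    using mult_right_mono[OF nbr_funpow_bound[OF assms, where n = n and i = i],
        where c = "\<bar>t\<bar> ^ n / fact n"]
    by (simp add: abs_mult power_abs power_mult_distrib divide_inverse mult_ac)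
qed

lemma nbr_exp_0: "nbr_exp d k x i 0 = x i"
  unfolding nbr_exp_def by (subst powser_zero) simp

lemma nbr_funpow_nonneg:
  assumes "k > 1" "d > 0" "\<And>i. x i \<ge> 0"
  shows "(nbr d k ^^ n) x i \<ge> 0"
  by (induction n arbitrary: i) (use assms in \<open>auto simp: nbr_def\<close>)

lemma nbr_exp_ge:
  assumes "k > 1" "d > 0" "\<And>i. \<bar>x i\<bar> \<le> M" "\<And>i. x i \<ge> 0" "t \<ge> 0"
  shows "nbr_exp d k x i t \<ge> x i"
proof -
  have "(\<Sum>n\<in>{0}. ((nbr d k ^^ n) x i / fact n) * t ^ n) \<le> nbr_exp d k x i t"
    unfolding nbr_exp_def
    by (rule sum_le_suminf[OF nbr_exp_summable[OF assms(1-3)]])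
      (use nbr_funpow_nonneg[OF assms(1,2,4)] assms(5) in auto)
  then show ?thesis by simp
qed

lemma nbr_funpow_linear:
  "(nbr d k ^^ n) (\<lambda>i. p * x i + q * y i) = (\<lambda>i. p * (nbr d k ^^ n) x i + q * (nbr d k ^^ n) y i)"
  by (induction n) (auto simp: nbr_def fun_eq_iff algebra_simps)

lemma nbr_exp_linear:
  assumes "k > 1" "d > 0" "\<And>i. \<bar>x i\<bar> \<le> M" "\<And>i. \<bar>y i\<bar> \<le> N"
  shows "nbr_exp d k (\<lambda>i. p * x i + q * y i) i t = p * nbr_exp d k x i t + q * nbr_exp d k y i t"
proof -
  note sx = nbr_exp_summable[OF assms(1-3), where i = i and t = t]
  note sy = nbr_exp_summable[OF assms(1,2,4), where i = i and t = t]
  have "nbr_exp d k (\<lambda>i. p * x i + q * y i) i t =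
     (\<Sum>n. p * (((nbr d k ^^ n) x i / fact n) * t ^ n) + q * (((nbr d k ^^ n) y i / fact n) * t ^ n))"
    unfolding nbr_exp_def nbr_funpow_linear
    by (intro suminf_cong) (simp add: add_divide_distrib algebra_simps)
  also have "\<dots> = (\<Sum>n. p * (((nbr d k ^^ n) x i / fact n) * t ^ n)) +
                    (\<Sum>n. q * (((nbr d k ^^ n) y i / fact n) * t ^ n))"
    by (intro suminf_add[symmetric] summable_mult sx sy)
  also have "\<dots> = p * nbr_exp d k x i t + q * nbr_exp d k y i t"
    unfolding nbr_exp_def by (simp only: suminf_mult[OF sx] suminf_mult[OF sy])
  finally show ?thesis .
qed

lemma nbr_exp_nbr:
  assumes "k > 1" "d > 0" "\<And>i. \<bar>x i\<bar> \<le> M"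
  shows "nbr_exp d k (nbr d k x) i t = nbr d k (\<lambda>i. nbr_exp d k x i t) i"
proof -
  let ?s = "\<lambda>i n. ((nbr d k ^^ n) x i / fact n) * t ^ n"
  note s = nbr_exp_summable[OF assms, where t = t]
  have "nbr_exp d k (nbr d k x) i t = (\<Sum>n. (d * k) * ?s (i + 1) n + d * ?s (i - 1) n)"
    unfolding nbr_exp_def funpow_swap1[symmetric]
    by (intro suminf_cong) (simp add: nbr_def add_divide_distrib algebra_simps)
  also have "\<dots> = (\<Sum>n. (d * k) * ?s (i + 1) n) + (\<Sum>n. d * ?s (i - 1) n)"
    by (intro suminf_add[symmetric] summable_mult s)
  also have "\<dots> = (d * k) * nbr_exp d k x (i + 1) t + d * nbr_exp d k x (i - 1) t"
    unfolding nbr_exp_def by (simp only: suminf_mult[OF s])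
  finally show ?thesis by (simp add: nbr_def algebra_simps)
qed

lemma nbr_exp_deriv:
  assumes "k > 1" "d > 0" "\<And>i. \<bar>x i\<bar> \<le> M"
  shows "((\<lambda>t. nbr_exp d k x i t) has_real_derivative nbr_exp d k (nbr d k x) i t) (at t)"
proof -
  let ?c = "\<lambda>n. (nbr d k ^^ n) x i / fact n"
  have "((\<lambda>t. \<Sum>n. ?c n * t ^ n) has_real_derivative (\<Sum>n. diffs ?c n * t ^ n)) (at t)"
    by (rule termdiffs_strong_converges_everywhere) (rule nbr_exp_summable[OF assms])
  moreover have "diffs ?c = (\<lambda>n. (nbr d k ^^ n) (nbr d k x) i / fact n)"
    by (auto simp: diffs_def fun_eq_iff funpow_swap1 field_simps simp del: of_nat_Suc)
  ultimately show ?thesis unfolding nbr_exp_def by simp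
qed

lemma endpoint_wave_not_stable:
  assumes k: "k > 1" and d: "d > 0" and w: "pinned_monotone_wave d k a u" and u0: "u 0 = a"
  shows "\<not> wave_stable d k a u"
proof
  assume st: "wave_stable d k a u"
  define c where "c = d * (k + 1) + 1"
  have c: "c > 0" using k d by (simp add: c_def add_pos_pos)
  define v where "v = (\<lambda>i. u i - u (i - 1))"
  define e0 where "e0 = (\<lambda>i::int. if i = 0 then 1 else 0 :: real)"
  note rng = pinned_monotone_wave_range[OF w]
  have sm: "strict_mono u" by (rule pinned_monotone_wave_strict_mono[OF k d w])
  have lt: "u i < a \<longleftrightarrow> i < 0" for i using strict_mono_less[OF sm, of i 0] u0 by simp
  have stepi: "u (i - 1) \<le> u i" for i using strict_monoD[OF sm, of "i - 1" i] by simp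
  have vb: "\<bar>v i\<bar> \<le> 1" for i unfolding v_def using rng[of i] rng[of "i - 1"] by linarith
  have v0: "v i \<ge> 0" for i unfolding v_def using stepi[of i] by simp
  have v00: "v 0 > 0" unfolding v_def using strict_monoD[OF sm, of "-1" 0] by simp
  have eb: "\<bar>e0 i\<bar> \<le> 1" and e0: "e0 i \<ge> 0" for i by (auto simp: e0_def)
  have equ: "nbr d k u i - c * u i + (if i < 0 then 0 else 1) = 0" for i
    using w lt[of i]
    by (auto simp: pinned_monotone_wave_def lattice_rhs_def g_MK_def nbr_def c_def algebra_simps
        split: if_splits dest!: spec[of _ i])
  have eqv: "nbr d k v i = c * v i - e0 i" for i
    using equ[of i] equ[of "i - 1"]
    by (cases "i = 0") (auto simp: v_def nbr_def e0_def algebra_simps split: if_splits)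

  define E where "E = (\<lambda>x i t. exp (- c * t) * nbr_exp d k x i t)"
  have dE: "((\<lambda>t. E x i t) has_real_derivative nbr d k (\<lambda>i. E x i t) i - c * E x i t) (at t)"
    if b: "\<And>i. \<bar>x i\<bar> \<le> M" for x M i t
    unfolding E_def
    by (rule derivative_eq_intros nbr_exp_deriv[OF k d b] refl)+
      (simp add: nbr_exp_nbr[OF k d b] nbr_def algebra_simps)
  have Epos: "E x i t \<ge> exp (- c * t) * x i" "E x i t \<ge> 0"
    if "\<And>i. \<bar>x i\<bar> \<le> M" "\<And>i. x i \<ge> 0" "t \<ge> 0" for x M i t
  proof -
    show "E x i t \<ge> exp (- c * t) * x i"
      unfolding E_def using nbr_exp_ge[OF k d that(1,2,3), where i = i] by (intro mult_left_mono) auto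
    then show "E x i t \<ge> 0" using that(2)[of i] by (meson exp_ge_zero mult_nonneg_nonneg order_trans)
  qed
  have dEv: "((\<lambda>t. E v i t) has_real_derivative - E e0 i t) (at t)" for i t
  proof -
    have "nbr d k v = (\<lambda>i. c * v i + (-1) * e0 i)" using eqv by (simp add: fun_eq_iff)
    then have eq: "nbr_exp d k (nbr d k v) i t = c * nbr_exp d k v i t - nbr_exp d k e0 i t"
      using nbr_exp_linear[where x = v and y = e0 and p = c and q = "- 1" and i = i and t = t,
          OF k d vb eb] by simp
    show ?thesis
      unfolding E_def
      by ((rule derivative_eq_intros nbr_exp_deriv[OF k d vb] refl)+, simp only: eq)
        (simp add: algebra_simps)
  qed
  have Ev: "E v i t \<le> v i" if "t \<ge> 0" for i t
  proof -
    have "E v i t \<le> E v i 0"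
      by (rule DERIV_nonpos_imp_nonincreasing[OF that])
        (use dEv Epos(2)[OF eb e0] in fastforce)
    then show ?thesis by (simp add: E_def nbr_exp_0)
  qed

  define \<epsilon> where "\<epsilon> = 1 / (2 * (2 * c))"
  have \<epsilon>: "\<epsilon> > 0" using c by (simp add: \<epsilon>_def)
  obtain \<delta> where \<delta>: "\<delta> > 0" and stab': "\<forall>v. lattice_solution d k a v \<longrightarrow>
      (\<forall>t\<ge>0. bounded (range (v t))) \<longrightarrow> (SUP i. \<bar>v 0 i - u i\<bar>) < \<delta> \<longrightarrow>
      (\<forall>t\<ge>0. (SUP i. \<bar>v t i - u i\<bar>) < \<epsilon>)"
    using st[unfolded wave_stable_def, rule_format, OF \<epsilon>] by (elim exE conjE)
  have stab: "(SUP i. \<bar>v t i - u i\<bar>) < \<epsilon>"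
    if "lattice_solution d k a v" "\<And>t. t \<ge> 0 \<Longrightarrow> bounded (range (v t))"
      "(SUP i. \<bar>v 0 i - u i\<bar>) < \<delta>" "t \<ge> 0" for v t
    using stab'[rule_format, OF that] .
  define \<eta> where "\<eta> = min (v 0) (\<delta> / 2)"
  have \<eta>: "\<eta> > 0" "\<eta> \<le> v 0" "\<eta> < \<delta>" using \<delta> v00 by (auto simp: \<eta>_def)
  define y where "y = (\<lambda>i. 1 * v i + (- \<eta>) * e0 i)"
  have y0: "y i \<ge> 0" for i using \<eta> v0[of i] by (auto simp: y_def e0_def)
  have yb: "\<bar>y i\<bar> \<le> 1" for i using y0[of i] vb[of i] \<eta>(1) by (auto simp: y_def e0_def)
  have Ey: "E y i t = E v i t - \<eta> * E e0 i t" for i t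
    unfolding E_def y_def
    by (subst nbr_exp_linear[where x = v and y = e0 and p = 1 and q = "- \<eta>", OF k d vb eb])
      (simp add: algebra_simps)
  define z where "z = (\<lambda>t i. u (i - 1) + E y i t)"

  have zlo: "z t i \<ge> u (i - 1)" if "t \<ge> 0" for t i
    using Epos(2)[OF yb y0 that, where i = i] by (simp add: z_def)
  have zup: "z t i \<le> u i - \<eta> * E e0 i t" if "t \<ge> 0" for t i
    using Ev[OF that, of i] by (simp add: z_def Ey v_def)
  have zup': "z t i \<le> u i" if "t \<ge> 0" for t i
  proof -
    have "\<eta> * E e0 i t \<ge> 0" using Epos(2)[OF eb e0 that, where i = i] \<eta>(1) by simp
    then show ?thesis using zup[OF that, of i] by linarith
  qed
  have zpat: "z t i < a \<longleftrightarrow> i < 1" if "t \<ge> 0" for t i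
  proof -
    consider "i < 0" | "i = 0" | "i \<ge> 1" by linarith
    then show ?thesis
    proof cases
      case 1
      then show ?thesis using zup'[OF that, of i] lt[of i] by simp
    next
      case 2
      have "E e0 0 t \<ge> exp (- c * t) * e0 0" by (rule Epos(1)[OF eb e0 that])
      moreover have "exp (- c * t) * e0 0 > 0" by (simp add: e0_def)
      ultimately have "\<eta> * E e0 0 t > 0" using \<eta>(1) by (intro mult_pos_pos) linarith+
      then have "z t 0 < a" using zup[OF that, of 0] u0 by linarith
      then show ?thesis using 2 by simp
    next
      case 3
      then show ?thesis using zlo[OF that, of i] lt[of "i - 1"] by simp
    qed
  qed
  have dz: "((\<lambda>t. z t i) has_real_derivative nbr d k (z t) i - c * z t i + (if i < 1 then 0 else 1)) (at t)"
    for i t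
    unfolding z_def
    by (rule derivative_eq_intros dE[OF yb] refl)+
      (use equ[of "i - 1"] in \<open>auto simp: nbr_def algebra_simps split: if_splits\<close>)
  have rhs: "lattice_rhs d k a (z t) i = nbr d k (z t) i - c * z t i + (if i < 1 then 0 else 1)"
    if "t \<ge> 0" for i t
    using zpat[OF that, of i]
    by (auto simp: lattice_rhs_def g_MK_def nbr_def c_def algebra_simps)
  have sol: "lattice_solution d k a z"
  proof (rule classical_lattice_solution)
    show "continuous_on {0..} (\<lambda>t. z t i)" for i
      by (rule DERIV_continuous_on) (rule has_field_derivative_at_within[OF dz])
    show "((\<lambda>t. z t i) has_real_derivative lattice_rhs d k a (z t) i) (at t)" if "t > 0" for i t
      using dz[of i t] rhs[of t i] that by simp
  qed
  have zr: "0 \<le> z t i" "z t i \<le> 1" if "t \<ge> 0" for t i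
    using zlo[OF that, of i] zup'[OF that, of i] rng[of i] rng[of "i - 1"] by linarith+
  have bdd: "bounded (range (z t))" if "t \<ge> 0" for t
    using zr[OF that] by (intro boundedI[of _ 1]) auto
  have "\<bar>z 0 i - u i\<bar> \<le> \<eta>" for i
    using \<eta>(1) by (auto simp: z_def E_def nbr_exp_0 y_def v_def e0_def)
  then have "(SUP i. \<bar>z 0 i - u i\<bar>) \<le> \<eta>" by (intro cSUP_least) auto
  then have "(SUP i. \<bar>z t i - u i\<bar>) < \<epsilon>" if "t \<ge> 0" for t
    using stab[OF sol bdd _ that] \<eta>(3) by simp
  moreover have "\<bar>z t i - u i\<bar> \<le> (SUP i. \<bar>z t i - u i\<bar>)" if "t \<ge> 0" for t i
  proof (rule cSUP_upper)
    have "\<bar>z t i - u i\<bar> \<le> 1" for i using zr[OF that, of i] rng[of i] by linarith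
    then show "bdd_above (range (\<lambda>i. \<bar>z t i - u i\<bar>))" by (intro bdd_aboveI2)
  qed simp
  ultimately have near: "\<bar>z t i - u i\<bar> < \<epsilon>" if "t \<ge> 0" for t i
    using that by (meson le_less_trans)

  have slope: "nbr d k (z t) 0 - c * z t 0 + (if (0::int) < 1 then 0 else 1) \<le> - 1 / 2"
    if "t \<ge> 0" for t
  proof -
    have nz: "nbr d k (z t) 0 \<le> nbr d k u 0"
      unfolding nbr_def using zup'[OF that] k d by (intro mult_left_mono add_mono) auto
    have "c * (u 0 - z t 0) \<le> c * \<epsilon>" using near[OF that, of 0] c by (intro mult_left_mono) auto
    also have "\<dots> \<le> 1 / 2" using c by (simp add: \<epsilon>_def)
    finally have "c * (u 0 - z t 0) \<le> 1 / 2" .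
    then show ?thesis using nz equ[of 0] by (simp add: algebra_simps)
  qed
  have "z 4 0 + 4 / 2 \<le> z 0 0 + 0 / 2"
  proof (rule DERIV_nonpos_imp_nonincreasing[where f = "\<lambda>t. z t 0 + t / 2"])
    fix t :: real assume t: "0 \<le> t" "t \<le> 4"
    have "((\<lambda>t. z t 0 + t / 2) has_real_derivative
        nbr d k (z t) 0 - c * z t 0 + (if (0::int) < 1 then 0 else 1) + 1 / 2) (at t)"
      by (intro DERIV_add dz DERIV_cdivide DERIV_ident)
    then show "\<exists>y. ((\<lambda>t. z t 0 + t / 2) has_real_derivative y) (at t) \<and> y \<le> 0"
      using slope[OF t(1)] by (intro exI conjI) auto
  qed simp
  then show False using zr[of 4 0] zr[of 0 0] by simp
qed

lemma endpoint_wave_exists: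
  assumes k: "k > 1" and d: "d > 0"
  shows "0 < a_plus d k" "a_plus d k < 1"
    "\<exists>u. pinned_monotone_wave d k (a_plus d k) u \<and> u 0 = a_plus d k"
proof -
  define c where "c = 1 + d * (k + 1)"
  define s where "s = sqrt (c\<^sup>2 - 4 * d\<^sup>2 * k)"
  define r where "r = (c + s) / (2 * d * k)"
  define q where "q = (c - s) / (2 * d * k)"
  have dk: "d * k > 0" using k d by simp
  have disc: "c\<^sup>2 - 4 * d\<^sup>2 * k = ((k - 1) * d + 1)\<^sup>2 + 4 * d"
    "c\<^sup>2 - 4 * d\<^sup>2 * k = (2 * d * k - c)\<^sup>2 + 4 * d * k"
    by (simp_all add: c_def power2_eq_square algebra_simps)
  have s2: "s\<^sup>2 = c\<^sup>2 - 4 * d\<^sup>2 * k"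
    unfolding s_def by (rule real_sqrt_pow2) (use disc(1) d in simp)
  have s1: "s > (k - 1) * d + 1"
    unfolding s_def by (rule real_less_rsqrt) (use disc(1) d in simp)
  have s3: "s > \<bar>2 * d * k - c\<bar>"
    unfolding s_def by (rule real_less_rsqrt) (use disc(2) dk in simp)
  have s0: "s > 0" using s3 by linarith
  have "s\<^sup>2 < c\<^sup>2" unfolding s2 using k d by simp
  moreover have c0: "c > 0" unfolding c_def using k d by (simp add: add_pos_pos)
  ultimately have s4: "s < c" by (simp add: power2_less_imp_less)
  have r1: "r > 1" and q0: "q > 0" and q1: "q < 1"
    unfolding r_def q_def using s3 s4 dk by (auto simp: divide_simps)
  have rq: "r - q = s / (d * k)" unfolding r_def q_def using k d by (simp add: field_simps)
  have quad: "d * k * x\<^sup>2 - c * x + d = 0" if "(2 * d * k * x - c)\<^sup>2 = s\<^sup>2" for x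
  proof -
    have "4 * (d * k) * (d * k * x\<^sup>2 - c * x + d) = (2 * d * k * x - c)\<^sup>2 - (c\<^sup>2 - 4 * d\<^sup>2 * k)"
      by (simp add: power2_eq_square algebra_simps)
    then show ?thesis using that s2 dk by auto
  qed
  have xr: "2 * d * k * r - c = s" and xq: "2 * d * k * q - c = - s"
    using k d by (simp_all add: r_def q_def)
  have rr: "d * k * r\<^sup>2 - c * r + d = 0" and qq: "d * k * q\<^sup>2 - c * q + d = 0"
    by (rule quad, simp add: xr xq)+
  define A where "A = r * (1 - q) / (r - q)"
  define B where "B = q * (r - 1) / (r - q)"
  have AB: "A > 0" "B > 0" using r1 q0 q1 by (auto simp: A_def B_def)
  have rq0: "r - q \<noteq> 0" using r1 q1 by simp
  have "r * (1 - q) + q * (r - 1) = r - q" "(1 - q) + (r - 1) = r - q"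
    by (simp_all add: algebra_simps)
  moreover have "A / r = (1 - q) / (r - q)" "B / q = (r - 1) / (r - q)"
    using r1 q0 by (simp_all add: A_def B_def)
  ultimately have AB1: "A + B = 1" "A / r + B / q = 1"
    unfolding A_def B_def by (simp_all only: add_divide_distrib[symmetric] divide_self[OF rq0])
  have prod: "d * k * (r * q) = d"
  proof -
    have "4 * (d * k) * (d * k * (r * q)) = (2 * d * k * r) * (2 * d * k * q)" by simp
    also have "2 * d * k * r = c + s" using xr by linarith
    also have "2 * d * k * q = c - s" using xq by linarith
    also have "(c + s) * (c - s) = 4 * (d * k) * d" using s2 by (simp add: power2_eq_square algebra_simps)
    finally show ?thesis using k d by auto
  qed
  have Aa: "A = a_plus d k"
  proof -
    have "A = (d * k * r - d * k * (r * q)) / s"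
      unfolding A_def rq using dk by (simp add: algebra_simps)
    also have "\<dots> = ((c + s) / 2 - d) / s" unfolding prod using xr by simp
    also have "\<dots> = 1 / 2 * (1 + ((k - 1) * d + 1) / s)"
      using s0 by (simp add: field_simps c_def)
    finally show ?thesis by (simp add: a_plus_def s_def c_def)
  qed
  show "0 < a_plus d k" "a_plus d k < 1" using AB AB1(1) Aa by auto

  define u where "u i = (if i \<le> 0 then A * r powi i else 1 - B * q powi i)" for i :: int
  have ulo: "u i = A * r powi i" if "i \<le> 0" for i using that by (simp add: u_def)
  have uhi: "u i = 1 - B * q powi i" if h: "i \<ge> -1" for i
  proof -
    consider "i = -1" | "i = 0" | "i > 0" using h by linarith
    then show ?thesis
      by cases (use AB1 in \<open>auto simp: u_def power_int_minus field_simps\<close>)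
  qed
  have step: "u i < u (i + 1)" for i
  proof (cases "i + 1 \<le> 0")
    case True
    have "A * r powi i < A * (r powi i * r)" using AB r1 by simp
    then show ?thesis using True r1 by (simp add: ulo power_int_add)
  next
    case False
    have "B * (q powi i * q) < B * q powi i" using AB q0 q1 by simp
    then show ?thesis using False q0 by (simp add: uhi power_int_add)
  qed
  have sm: "strict_mono u"
  proof (rule strict_monoI)
    fix x y :: int assume "x < y"
    then show "u x < u y"
      by (induction rule: int_gr_induct) (use step in \<open>auto intro: less_trans\<close>)
  qed
  have u0: "u 0 = a_plus d k" by (simp add: u_def Aa)
  have lt: "u i < a_plus d k \<longleftrightarrow> i < 0" for i using strict_mono_less[OF sm, of i 0] u0 by simp
  have eq: "0 = lattice_rhs d k (a_plus d k) u i" for i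
  proof (cases "i < 0")
    case True
    have "d * k * (r * r) - c * r + d = 0" using rr by (simp add: power2_eq_square)
    then have "A * r powi (i - 1) * (d * k * (r * r) - c * r + d) = 0" by simp
    moreover have "r powi i = r powi (i - 1) * r" "r powi (i + 1) = r powi (i - 1) * (r * r)"
      using power_int_add[of r "i - 1" 1] power_int_add[of r "i - 1" 2] r1
      by (auto simp: power2_eq_square add.commute)
    ultimately show ?thesis
      using True lt[of i]
      by (simp add: lattice_rhs_def g_MK_def ulo c_def algebra_simps)
  next
    case False
    have "d * k * (q * q) - c * q + d = 0" using qq by (simp add: power2_eq_square)
    then have "B * q powi (i - 1) * (d * k * (q * q) - c * q + d) = 0" by simp
    moreover have "q powi i = q powi (i - 1) * q" "q powi (i + 1) = q powi (i - 1) * (q * q)"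
      using power_int_add[of q "i - 1" 1] power_int_add[of q "i - 1" 2] q0
      by (auto simp: power2_eq_square add.commute)
    ultimately show ?thesis
      using False lt[of i]
      by (simp add: lattice_rhs_def g_MK_def uhi c_def algebra_simps)
  qed
  have bot: "(u \<longlongrightarrow> 0) at_bot"
  proof -
    have "filterlim (\<lambda>i::int. nat (- i)) at_top at_bot"
      unfolding filterlim_at_top
    proof
      fix Z :: nat
      show "eventually (\<lambda>i::int. Z \<le> nat (- i)) at_bot"
        using eventually_le_at_bot[of "- int Z"] by eventually_elim linarith
    qed
    moreover have "(\<lambda>n. A * inverse r ^ n) \<longlonglongrightarrow> A * 0"
      using r1 by (intro tendsto_intros LIMSEQ_realpow_zero) (auto simp: field_simps)
    ultimately have "((\<lambda>i::int. A * inverse r ^ nat (- i)) \<longlongrightarrow> A * 0) at_bot"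
      by (rule filterlim_compose[rotated])
    moreover have "eventually (\<lambda>i. A * inverse r ^ nat (- i) = u i) at_bot"
      using eventually_le_at_bot[of 0]
      by eventually_elim (auto simp: ulo power_int_def power_inverse)
    ultimately show ?thesis using tendsto_cong by fastforce
  qed
  have top: "(u \<longlongrightarrow> 1) at_top"
  proof -
    have "filterlim (\<lambda>i::int. nat i) at_top at_top"
      unfolding filterlim_at_top
    proof
      fix Z :: nat
      show "eventually (\<lambda>i::int. Z \<le> nat (i)) at_top"
        using eventually_ge_at_top[of "int Z"] by eventually_elim linarith
    qed
    moreover have "(\<lambda>n. 1 - B * q ^ n) \<longlonglongrightarrow> 1 - B * 0"
      using q0 q1 by (intro tendsto_intros LIMSEQ_realpow_zero) auto
    ultimately have "((\<lambda>i::int. 1 - B * q ^ nat i) \<longlongrightarrow> 1 - B * 0) at_top"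
      by (rule filterlim_compose[rotated])
    moreover have "eventually (\<lambda>i. 1 - B * q ^ nat i = u i) at_top"
      using eventually_ge_at_top[of 0]
      by eventually_elim (auto simp: uhi power_int_def)
    ultimately show ?thesis using tendsto_cong by fastforce
  qed
  have "pinned_monotone_wave d k (a_plus d k) u"
    using eq sm bot top strict_mono_mono by (auto simp: pinned_monotone_wave_def)
  then show "\<exists>u. pinned_monotone_wave d k (a_plus d k) u \<and> u 0 = a_plus d k"
    using u0 by blast
qed

corollary pinned_monotone_wave_unstable_at_a_plus:
  assumes "k > 1" and "d > 0"
  shows "0 < a_plus d k" "a_plus d k < 1"
    "\<exists>u. pinned_monotone_wave d k (a_plus d k) u \<and> \<not> wave_stable d k (a_plus d k) u"
  using endpoint_wave_exists[OF assms] endpoint_wave_not_stable[OF assms] by blast+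

end

theory Submission
  imports Defs
begin

text \<open>
  A pinned wave with \<open>u i < a \<longleftrightarrow> i < n\<close> solves a linear recurrence with a step source at \<open>n\<close>.  The
  difference of two such solutions is bounded and homogeneous, hence zero because
  \<open>d * (k + 1) < d * (k + 1) + 1\<close>.  So up to shifts there is a single profile, whose values at the
  step are \<open>a_plus\<close> and \<open>a_minus\<close>; it is a wave for \<open>a\<close> iff
  \<open>a_minus < a \<le> a_plus\<close>.

  If \<open>a\<close> lies strictly between them, a solution that is uniformly close to the wave stays on the same
  side of \<open>a\<close> at every site, its deviation obeys a linear equation with a maximum principle, and so
  the supremum of the deviation cannot grow.  To continue this in time, the solution must be
  bounded in \<open>i\<close> locally uniformly in \<open>t\<close>, whereas it is only assumed bounded in \<open>i\<close> for each \<open>t\<close>.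
  Baire's theorem closes this gap: the times without a locally uniform bound form a closed set, and
  on some relatively open part of it the bound is uniform; since the equation controls growth
  both forwards and backwards in time, the bound extends to the gaps in between.
\<close>

section \<open>Uniqueness of the wave profile and the existence criterion\<close>

text \<open>The supremum \<open>S\<close> of \<open>\<bar>x i\<bar>\<close> need not be attained, so
  the inequality is first divided by its left coefficient and the supremum is taken afterwards. This
  gives \<open>(d * (k + 1) + 1) * S \<le> d * (k + 1) * S\<close>, hence
  \<open>S \<le> 0\<close>.\<close>

lemma bounded_subsolution_zero:
  fixes x :: "int \<Rightarrow> real"
  assumes "k > 1" "d > 0" and bd: "\<And>i. \<bar>x i\<bar> \<le> M"
    and le: "\<And>i. (d * (k + 1) + 1) * \<bar>x i\<bar> \<le> d * (k * \<bar>x (i + 1)\<bar> + \<bar>x (i - 1)\<bar>)"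
  shows "x i = 0"
proof -
  define S where "S = (SUP i. \<bar>x i\<bar>)"
  have up: "\<bar>x i\<bar> \<le> S" for i
    unfolding S_def by (rule cSUP_upper) (use bd in \<open>auto intro!: bdd_aboveI2\<close>)
  have p: "d * (k + 1) + 1 > 0" using assms(1,2) by (simp add: add_pos_pos)
  have "\<bar>x i\<bar> \<le> d * (k + 1) * S / (d * (k + 1) + 1)" for i
  proof -
    have "d * (k * \<bar>x (i + 1)\<bar> + \<bar>x (i - 1)\<bar>) \<le> d * (k * S + S)"
      using up assms(1,2) by (intro mult_left_mono add_mono) auto
    then have "(d * (k + 1) + 1) * \<bar>x i\<bar> \<le> d * (k + 1) * S"
      using le[of i] by (simp add: algebra_simps)
    then show ?thesis using p by (simp add: pos_le_divide_eq mult.commute)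
  qed
  then have "S \<le> d * (k + 1) * S / (d * (k + 1) + 1)"
    unfolding S_def by (intro cSUP_least) auto
  then have "S * (d * (k + 1) + 1) \<le> d * (k + 1) * S"
    using p by (simp add: pos_le_divide_eq)
  then have "S \<le> 0" by (simp add: algebra_simps)
  then show ?thesis using up[of i] by simp
qed

lemma pinned_monotone_wave_threshold:
  assumes w: "pinned_monotone_wave d k a u" and a: "0 < a" "a < 1"
  obtains n where "\<And>i. u i < a \<longleftrightarrow> i < n"
proof -
  have m: "mono u" and l: "(u \<longlongrightarrow> 0) at_bot" "(u \<longlongrightarrow> 1) at_top"
    using w by (auto simp: pinned_monotone_wave_def)
  obtain lo where lo: "u lo < a"
    using order_tendstoD(2)[OF l(1) a(1)] by (auto simp: eventually_at_bot_linorder)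
  obtain hi where hi: "u hi > a"
    using order_tendstoD(1)[OF l(2) a(2)] by (auto simp: eventually_at_top_linorder)
  have "lo \<le> hi" using monoD[OF m, of hi lo] lo hi by (meson le_less_linear less_imp_le not_le order_trans)
  then have ex: "u (lo + int (nat (hi - lo))) \<ge> a" using hi by simp
  define N where "N = (LEAST N. u (lo + int N) \<ge> a)"
  have N: "u (lo + int N) \<ge> a" unfolding N_def by (rule LeastI[of _ "nat (hi - lo)"]) (rule ex)
  have "u i < a \<longleftrightarrow> i < lo + int N" for i
  proof
    assume "u i < a"
    then show "i < lo + int N" using N monoD[OF m, of "lo + int N" i] by (meson le_less_trans not_le)
  next
    assume i: "i < lo + int N"
    show "u i < a"
    proof (cases "i \<le> lo")
      case True
      then show ?thesis using monoD[OF m] lo by (meson le_less_trans)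
    next
      case False
      then have "nat (i - lo) < N" using i by linarith
      then show ?thesis using not_less_Least[of "nat (i - lo)" "\<lambda>N. u (lo + int N) \<ge> a"] False
        by (simp add: N_def)
    qed
  qed
  then show ?thesis using that by blast
qed

text \<open>Once the steps are aligned, the jump terms of both equations switch on at the same site
  and cancel in the difference, which is bounded and homogeneous. The thresholds \<open>a\<close>
  and \<open>b\<close> may differ, so that any wave can be compared with the explicit one at
  \<open>a_plus\<close>.\<close>

lemma pinned_monotone_wave_eq_shift:
  assumes "k > 1" "d > 0"
    and u: "pinned_monotone_wave d k a u" "\<And>i. u i < a \<longleftrightarrow> i < m"
    and w: "pinned_monotone_wave d k b w" "\<And>i. w i < b \<longleftrightarrow> i < n"
  shows "u (i + m) = w (i + n)"
proof -
  define x where "x i = u (i + m) - w (i + n)" for i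
  have "x i = 0" for i
  proof (rule bounded_subsolution_zero[OF assms(1,2), where M = 1])
    show "\<bar>x i\<bar> \<le> 1" for i
      using pinned_monotone_wave_range[OF u(1), of "i + m"]
        pinned_monotone_wave_range[OF w(1), of "i + n"] by (simp add: x_def)
    fix i
    have e: "0 = lattice_rhs d k a u (i + m)" "0 = lattice_rhs d k b w (i + n)"
      using u(1) w(1) by (auto simp: pinned_monotone_wave_def)
    have "(d * (k + 1) + 1) * x i = d * (k * x (i + 1) + x (i - 1))"
      using e u(2)[of "i + m"] w(2)[of "i + n"]
      by (auto simp: lattice_rhs_def g_MK_def x_def algebra_simps split: if_splits)
    then have "\<bar>(d * (k + 1) + 1) * x i\<bar> = \<bar>d * (k * x (i + 1) + x (i - 1))\<bar>" by simp
    moreover have "d * (k + 1) + 1 > 0" using assms(1,2) by (simp add: add_pos_pos)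
    moreover have "\<bar>k * x (i + 1) + x (i - 1)\<bar> \<le> k * \<bar>x (i + 1)\<bar> + \<bar>x (i - 1)\<bar>"
      using assms(1) abs_triangle_ineq[of "k * x (i + 1)" "x (i - 1)"] by (simp add: abs_mult)
    ultimately show "(d * (k + 1) + 1) * \<bar>x i\<bar> \<le> d * (k * \<bar>x (i + 1)\<bar> + \<bar>x (i - 1)\<bar>)"
      using assms(2) by (simp add: abs_mult)
  qed
  then show ?thesis by (simp add: x_def)
qed

text \<open>Left of the step the recurrence is linear and factors through its two backward modes.
  The mode with ratio \<open>P > 1\<close> does not decay as i tends to minus infinity, so only the
  mode \<open>p\<close> survives and \<open>w (-1) = p * w 0\<close>.\<close>

lemma endpoint_wave_left_neighbour:
  assumes k: "k > 1" and d: "d > 0"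
    and w: "pinned_monotone_wave d k (a_plus d k) w" and w0: "w 0 = a_plus d k"
  shows "w (-1) = a_minus d k"
proof -
  define m c s where "m = (k - 1) * d" "c = 1 + d * (k + 1)" "s = sqrt (c\<^sup>2 - 4 * d\<^sup>2 * k)"
  note defs = this
  \<comment> \<open>The first form feeds the closing computation; the second gives
    \<open>s > \<bar>c - 2 * d\<bar>\<close>, which is what makes \<open>P > 1\<close>.\<close>
  have disc: "c\<^sup>2 - 4 * d\<^sup>2 * k = (m + 1)\<^sup>2 + 4 * d"
    "c\<^sup>2 - 4 * d\<^sup>2 * k = (c - 2 * d)\<^sup>2 + 4 * d"
    by (simp_all add: defs(1,2) power2_eq_square algebra_simps)
  have s2: "s\<^sup>2 = (m + 1)\<^sup>2 + 4 * d"
    unfolding defs(3) disc(1) by (rule real_sqrt_pow2) (use d in simp)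
  have s3: "s > \<bar>c - 2 * d\<bar>"
    unfolding defs(3) by (rule real_less_rsqrt) (use disc(2) d in simp)
  \<comment> \<open>These are the roots of d x^2 - c x + d k, the characteristic polynomial for the
    ratio of \<open>w (i - 1)\<close> to \<open>w i\<close>.\<close>
  define p P where "p = (c - s) / (2 * d)" "P = (c + s) / (2 * d)"
  note pdefs = this
  have P1: "P > 1" using s3 d by (simp add: pdefs)
  have sum: "d * (p + P) = c" using d by (simp add: pdefs field_simps)
  have prod: "d * (p * P) = d * k"
  proof -
    have "4 * d * (d * (p * P)) = (c - s) * (c + s)" using d by (simp add: pdefs)
    also have "\<dots> = 4 * d * (d * k)"
      using s2 disc(1) by (simp add: power2_eq_square algebra_simps)
    finally show ?thesis using d by simp
  qed
  have sm: "strict_mono w" by (rule pinned_monotone_wave_strict_mono[OF k d w])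
  have lt: "w i < a_plus d k \<longleftrightarrow> i < 0" for i using strict_mono_less[OF sm, of i 0] w0 by simp
  \<comment> \<open>Removing the \<open>p\<close> mode leaves a first-order recurrence. Its solution
    cannot shrink to the left, yet it tends to 0 there, so \<open>y 0 = 0\<close>.\<close>
  define y where "y i = w (i - 1) - p * w i" for i
  have step: "y i = P * y (i + 1)" if "i < 0" for i
  proof -
    have "d * k * w (i + 1) - c * w i + d * w (i - 1) = 0"
      using w lt[of i] that
      by (auto simp: pinned_monotone_wave_def lattice_rhs_def g_MK_def defs(2) algebra_simps
          dest!: spec[of _ i])
    then have "d * (p * P) * w (i + 1) - d * (p + P) * w i + d * w (i - 1) = 0"
      by (simp only: sum prod)
    then have "d * (y i - P * y (i + 1)) = 0" by (simp add: y_def algebra_simps)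
    then show ?thesis using d by simp
  qed
  have grow: "\<bar>y (- int n)\<bar> \<ge> \<bar>y 0\<bar>" for n
  proof (induction n)
    case (Suc n)
    have "\<bar>y (- int (Suc n))\<bar> = P * \<bar>y (- int n)\<bar>"
      using step[of "- int (Suc n)"] P1 by (simp add: abs_mult)
    also have "\<dots> \<ge> 1 * \<bar>y (- int n)\<bar>" using P1 by (intro mult_right_mono) auto
    finally show ?case using Suc by simp
  qed simp
  have wl: "(\<lambda>n. w (- int n)) \<longlonglongrightarrow> 0"
  proof (rule filterlim_compose[of w])
    show "(w \<longlongrightarrow> 0) at_bot" using w by (simp add: pinned_monotone_wave_def)
    show "filterlim (\<lambda>n. - int n) at_bot sequentially"
      unfolding filterlim_at_bot
    proof
      fix Z
      show "\<forall>\<^sub>F n in sequentially. - int n \<le> Z"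
        using eventually_ge_at_top[of "nat (- Z)"] by eventually_elim linarith
    qed
  qed
  have "(\<lambda>n. y (- int n)) \<longlonglongrightarrow> 0 - p * 0"
  proof -
    have "- int n - 1 = - int (Suc n)" for n by simp
    then show ?thesis unfolding y_def by (simp only:) (intro tendsto_intros wl LIMSEQ_Suc[OF wl])
  qed
  then have "(\<lambda>n. \<bar>y (- int n)\<bar>) \<longlonglongrightarrow> 0" by (simp add: tendsto_rabs_zero)
  then have "\<bar>y 0\<bar> \<le> 0" by (rule tendsto_lowerbound) (use grow in auto)
  then have "w (-1) = p * a_plus d k" by (simp add: y_def w0)
  also have "\<dots> = a_minus d k"
  proof -
    have s0: "s > 0" using s3 by linarith
    \<comment> \<open>The computation rests on c - m - 1 = 2d and s^2 = (m+1)^2 + 4d.\<close>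
    have "(s + m + 1) * (c - s) = s * (c - m - 1) + (m + 1) * c - s\<^sup>2"
      by (simp add: power2_eq_square algebra_simps)
    also have "\<dots> = 2 * d * (s + m - 1)"
      unfolding s2 by (simp add: defs(1,2) power2_eq_square algebra_simps)
    finally have e: "(s + m + 1) * (c - s) = 2 * d * (s + m - 1)" .
    have "a_plus d k = (s + m + 1) / (2 * s)" "a_minus d k = (s + m - 1) / (2 * s)"
      unfolding a_plus_def a_minus_def defs(2)[symmetric] defs(3)[symmetric] defs(1)[symmetric]
      using s0 by (simp_all add: field_simps)
    then have "p * a_plus d k = (s + m + 1) * (c - s) / (2 * d * (2 * s))"
      by (simp add: pdefs)
    also have "\<dots> = (s + m - 1) / (2 * s)" unfolding e using d s0 by (simp add: field_simps)
    finally show ?thesis using \<open>a_minus d k = _\<close> by simp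
  qed
  finally show ?thesis .
qed

lemma pinned_monotone_wave_at_threshold:
  assumes k: "k > 1" and d: "d > 0"
    and u: "pinned_monotone_wave d k a u" "\<And>i. u i < a \<longleftrightarrow> i < n"
  shows "u n = a_plus d k" "u (n - 1) = a_minus d k"
proof -
  obtain w where w: "pinned_monotone_wave d k (a_plus d k) w" "w 0 = a_plus d k"
    using endpoint_wave_exists(3)[OF k d] by blast
  have sm: "strict_mono w" by (rule pinned_monotone_wave_strict_mono[OF k d w(1)])
  have lt: "w i < a_plus d k \<longleftrightarrow> i < 0" for i using strict_mono_less[OF sm, of i 0] w(2) by simp
  note eq = pinned_monotone_wave_eq_shift[OF k d u w(1) lt]
  show "u n = a_plus d k" using eq[of 0] w(2) by simp
  show "u (n - 1) = a_minus d k"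
    using eq[of "-1"] endpoint_wave_left_neighbour[OF k d w] by simp
qed

lemma pinned_monotone_wave_exists_iff:
  assumes k: "k > 1" and d: "d > 0" and a: "0 < a" "a < 1"
  shows "(\<exists>u. pinned_monotone_wave d k a u) \<longleftrightarrow> a_minus d k < a \<and> a \<le> a_plus d k"
proof
  assume "\<exists>u. pinned_monotone_wave d k a u"
  then obtain u where u: "pinned_monotone_wave d k a u" by blast
  obtain n where n: "\<And>i. u i < a \<longleftrightarrow> i < n" using pinned_monotone_wave_threshold[OF u a] by blast
  show "a_minus d k < a \<and> a \<le> a_plus d k"
    using n[of n] n[of "n - 1"] pinned_monotone_wave_at_threshold[OF k d u n] by simp
next
  assume a': "a_minus d k < a \<and> a \<le> a_plus d k"
  obtain w where w: "pinned_monotone_wave d k (a_plus d k) w" "w 0 = a_plus d k"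
    using endpoint_wave_exists(3)[OF k d] by blast
  have sm: "strict_mono w" by (rule pinned_monotone_wave_strict_mono[OF k d w(1)])
  \<comment> \<open>No value of \<open>w\<close> lies strictly between its values at -1 and 0, which
    are \<open>a_minus\<close> and \<open>a_plus\<close>. Moving the threshold within this gap
    leaves the nonlinearity unchanged at every site, so one profile serves all admissible
    \<open>a\<close>.\<close>
  have "w i < a_plus d k \<longleftrightarrow> w i < a" for i
  proof (cases "i < 0")
    case True
    then have "w i \<le> w (-1)" using strict_mono_less_eq[OF sm] by simp
    then show ?thesis using a' endpoint_wave_left_neighbour[OF k d w] by simp
  next
    case False
    then have "w 0 \<le> w i" using strict_mono_less_eq[OF sm] by simp
    then show ?thesis using a' w(2) by simp
  qed
  then have "pinned_monotone_wave d k a w"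
    using w(1) by (simp add: pinned_monotone_wave_def lattice_rhs_def g_MK_def)
  then show "\<exists>u. pinned_monotone_wave d k a u" by blast
qed

section \<open>Regularity and a priori bounds for solutions of the integrated equation\<close>

lemma lattice_solution_has_integral:
  assumes v: "lattice_solution d k a v" and "0 \<le> s" "s \<le> t"
  shows "((\<lambda>x. lattice_rhs d k a (v x) i) has_integral (v t i - v s i)) {s..t}"
proof -
  let ?f = "\<lambda>x. lattice_rhs d k a (v x) i"
  have h: "(?f has_integral (v r i - v 0 i)) {0..r}" if "r \<ge> 0" for r
    using v that by (auto simp: lattice_solution_def)
  have int: "?f integrable_on {s..t}"
    by (rule integrable_on_subinterval[OF has_integral_integrable[OF h[of t]]]) (use assms in auto)
  have "integral {0..s} ?f + integral {s..t} ?f = integral {0..t} ?f"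
    by (rule Henstock_Kurzweil_Integration.integral_combine)
      (use assms has_integral_integrable[OF h[of t]] in auto)
  moreover have "integral {0..r} ?f = v r i - v 0 i" if "r \<ge> 0" for r
    using h[OF that] by (rule integral_unique)
  ultimately have "integral {s..t} ?f = v t i - v s i" using assms by simp
  then show ?thesis using integrable_integral[OF int] by simp
qed

lemma lattice_solution_continuous:
  assumes v: "lattice_solution d k a v"
  shows "continuous_on {0..} (\<lambda>t. v t i)"
proof -
  let ?f = "\<lambda>x. lattice_rhs d k a (v x) i"
  have c: "continuous_on {0..T} (\<lambda>t. v t i)" if "T \<ge> 0" for T
  proof -
    have "continuous_on {0..T} (\<lambda>t. v 0 i + integral {0..t} ?f)"
      using lattice_solution_has_integral[OF v order_refl that]
      by (intro continuous_intros indefinite_integral_continuous_1) blast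
    moreover have "v 0 i + integral {0..t} ?f = v t i" if "t \<in> {0..T}" for t
      using integral_unique[OF lattice_solution_has_integral[OF v order_refl, of t i]] that by simp
    ultimately show ?thesis by (metis (no_types, lifting) continuous_on_cong)
  qed
  show ?thesis
    unfolding continuous_on_eq_continuous_within
  proof
    fix x :: real assume x: "x \<in> {0..}"
    then have "continuous (at x within {0..x + 1}) (\<lambda>t. v t i)"
      using c[of "x + 1"] by (simp add: continuous_on_eq_continuous_within)
    moreover have "at x within {0..x + 1} = at x within {0..}"
      by (rule at_within_nhd[of _ "{..<x + 1}"]) auto
    ultimately show "continuous (at x within {0..}) (\<lambda>t. v t i)" by (simp add: continuous_within)
  qed
qed

lemma lattice_rhs_bound:
  assumes "k > 1" "d > 0" "\<And>j. \<bar>x j\<bar> \<le> K"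
  shows "\<bar>lattice_rhs d k a x i\<bar> \<le> (2 * d * (k + 1) + 1) * K + 1"
proof -
  have "\<bar>k * x (i + 1)\<bar> \<le> k * K" "\<bar>(k + 1) * x i\<bar> \<le> (k + 1) * K"
    using assms by (auto simp: abs_mult intro!: mult_left_mono)
  then have "\<bar>k * x (i + 1) - (k + 1) * x i + x (i - 1)\<bar> \<le> k * K + (k + 1) * K + K"
    using assms(3)[of "i - 1"] by linarith
  then have "\<bar>d * (k * x (i + 1) - (k + 1) * x i + x (i - 1))\<bar> \<le> d * (k * K + (k + 1) * K + K)"
    using assms(2) by (simp add: abs_mult)
  moreover have "\<bar>g_MK (x i) a\<bar> \<le> K + 1"
    using assms(3)[of i] by (auto simp: g_MK_def)
  moreover have "d * (k * K + (k + 1) * K + K) + (K + 1) = (2 * d * (k + 1) + 1) * K + 1"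
    by (simp add: algebra_simps)
  ultimately show ?thesis unfolding lattice_rhs_def by linarith
qed

text \<open>Using a segment instead of an interval admits \<open>t < s\<close>, so that growth is
  controlled backwards in time as well.\<close>

lemma lattice_solution_increment:
  assumes "k > 1" "d > 0" and v: "lattice_solution d k a v" and "0 \<le> s" "0 \<le> t"
    and K: "\<And>x j. x \<in> closed_segment s t \<Longrightarrow> \<bar>v x j\<bar> \<le> K"
  shows "\<bar>v t i - v s i\<bar> \<le> ((2 * d * (k + 1) + 1) * K + 1) * \<bar>t - s\<bar>"
proof -
  have *: "\<bar>v t i - v s i\<bar> \<le> ((2 * d * (k + 1) + 1) * K + 1) * (t - s)"
    if "0 \<le> s" "s \<le> t" and K: "\<And>x j. x \<in> {s..t} \<Longrightarrow> \<bar>v x j\<bar> \<le> K" for s t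
  proof -
    have "0 \<le> \<bar>lattice_rhs d k a (v s) i\<bar>" by simp
    also have "\<dots> \<le> (2 * d * (k + 1) + 1) * K + 1"
      using K that(2) by (intro lattice_rhs_bound[OF assms(1,2)]) simp
    finally have "norm (v t i - v s i) \<le> ((2 * d * (k + 1) + 1) * K + 1) * measure lborel {s..t}"
      using lattice_solution_has_integral[OF v that(1,2), of i] lattice_rhs_bound[OF assms(1,2) K]
      unfolding cbox_interval[symmetric]
      by (intro has_integral_bound[where f = "\<lambda>x. lattice_rhs d k a (v x) i"]) (auto simp: cbox_interval)
    then show ?thesis using that(2) by simp
  qed
  show ?thesis
  proof (cases "s \<le> t")
    case True
    then show ?thesis using *[of s t] assms K by (simp add: closed_segment_eq_real_ivl)
  next
    case False
    then show ?thesis using *[of t s] assms K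
      by (simp add: closed_segment_eq_real_ivl abs_minus_commute)
  qed
qed

text \<open>Absorption argument: a qualitative bound \<open>K\<close> makes the supremum
  \<open>P\<close> over the segment finite, and on a short segment
  \<open>P \<le> N + (P + 1) / 2\<close>. The resulting bound depends only on the values at time
  \<open>s\<close> and not on \<open>K\<close>.\<close>

lemma lattice_solution_short_time:
  assumes k: "k > 1" and d: "d > 0" and v: "lattice_solution d k a v" and st: "0 \<le> s" "0 \<le> t"
    and short: "(2 * d * (k + 1) + 1) * \<bar>t - s\<bar> \<le> 1 / 2"
    and K: "\<And>x j. x \<in> closed_segment s t \<Longrightarrow> \<bar>v x j\<bar> \<le> K"
    and N: "\<And>j. \<bar>v s j\<bar> \<le> N" and y: "y \<in> closed_segment s t"
  shows "\<bar>v y i\<bar> \<le> 2 * N + 1"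
proof -
  define C where "C = 2 * d * (k + 1) + 1"
  have C: "C \<ge> 1" using k d by (simp add: C_def)
  define I where "I = closed_segment s t \<times> (UNIV :: int set)"
  define P where "P = (SUP (x, j)\<in>I. \<bar>v x j\<bar>)"
  have P: "\<bar>v x j\<bar> \<le> P" if "x \<in> closed_segment s t" for x j
  proof -
    have "(case (x, j) of (x, j) \<Rightarrow> \<bar>v x j\<bar>) \<le> P"
      unfolding P_def by (rule cSUP_upper) (use K that in \<open>auto simp: I_def intro!: bdd_aboveI2\<close>)
    then show ?thesis by simp
  qed
  have P0: "P \<ge> 0" using P[OF y, of i] by linarith
  have "\<bar>v x j\<bar> \<le> N + (P + 1) / 2" if x: "x \<in> closed_segment s t" for x j
  proof -
    have sub: "closed_segment s x \<subseteq> closed_segment s t" "x \<ge> 0" "\<bar>x - s\<bar> \<le> \<bar>t - s\<bar>"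
      using x st by (auto simp: closed_segment_eq_real_ivl split: if_splits)
    have "\<bar>v x j - v s j\<bar> \<le> (C * P + 1) * \<bar>x - s\<bar>"
      unfolding C_def using sub P
      by (intro lattice_solution_increment[OF k d v st(1)]) auto
    also have "\<dots> \<le> (C * P + C) * \<bar>t - s\<bar>"
      using sub(3) C P0 by (intro mult_mono) auto
    also have "\<dots> = (C * \<bar>t - s\<bar>) * (P + 1)" by (simp add: algebra_simps)
    also have "\<dots> \<le> 1 / 2 * (P + 1)" using short P0 unfolding C_def by (intro mult_right_mono) auto
    finally show ?thesis using N[of j] by linarith
  qed
  then have "P \<le> N + (P + 1) / 2"
    unfolding P_def by (intro cSUP_least) (auto simp: I_def)
  then have "P \<le> 2 * N + 1" by (simp add: field_simps)
  then show ?thesis using P[OF y, of i] by (rule order_trans[rotated])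
qed

lemma compact_locally_bounded:
  fixes v :: "'a :: metric_space \<Rightarrow> 'b \<Rightarrow> real"
  assumes "compact A"
    and "\<And>t. t \<in> A \<Longrightarrow> \<exists>e>0. \<exists>K. \<forall>y\<in>A. dist t y < e \<longrightarrow> (\<forall>j. \<bar>v y j\<bar> \<le> K)"
  shows "\<exists>K. \<forall>y\<in>A. \<forall>j. \<bar>v y j\<bar> \<le> K"
proof -
  obtain e K where e: "\<And>t. t \<in> A \<Longrightarrow> e t > 0"
    and K: "\<And>t y j. t \<in> A \<Longrightarrow> y \<in> A \<Longrightarrow> dist t y < e t \<Longrightarrow> \<bar>v y j\<bar> \<le> K t"
    using assms(2) by metis
  obtain F where F: "F \<subseteq> A" "finite F" "A \<subseteq> (\<Union>t\<in>F. ball t (e t))"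
    by (rule compactE_image[OF assms(1), of A "\<lambda>t. ball t (e t)"]) (use e in force)+
  show ?thesis
  proof (intro exI ballI allI)
    fix y j assume "y \<in> A"
    then obtain t where t: "t \<in> F" "dist t y < e t" using F(3) by auto
    then have "\<bar>v y j\<bar> \<le> K t" using K F(1) \<open>y \<in> A\<close> by blast
    also have "\<dots> \<le> Max (K ` F)" using F(2) t by simp
    finally show "\<bar>v y j\<bar> \<le> Max (K ` F)" .
  qed
qed


lemma lattice_solution_locally_bounded:
  assumes k: "k > 1" and d: "d > 0" and v: "lattice_solution d k a v"
    and bd: "\<And>t. t \<ge> 0 \<Longrightarrow> bounded (range (v t))"
  shows "\<exists>K. \<forall>y\<in>{0..T}. \<forall>j. \<bar>v y j\<bar> \<le> K"
proof -
  define C where "C = 2 * d * (k + 1) + 1"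
  have C: "C \<ge> 1" using k d by (simp add: C_def)
  define good where
    "good t \<longleftrightarrow> (\<exists>e>0. \<exists>K. \<forall>y\<ge>0. dist t y < e \<longrightarrow> (\<forall>j. \<bar>v y j\<bar> \<le> K))" for t
  have good_bounded: "\<exists>K. \<forall>y\<in>A. \<forall>j. \<bar>v y j\<bar> \<le> K"
    if "compact A" "A \<subseteq> {0..}" "\<And>t. t \<in> A \<Longrightarrow> good t" for A
  proof (rule compact_locally_bounded[OF that(1)])
    fix t assume "t \<in> A"
    then show "\<exists>e>0. \<exists>K. \<forall>y\<in>A. dist t y < e \<longrightarrow> (\<forall>j. \<bar>v y j\<bar> \<le> K)"
      using that(2,3) unfolding good_def by fastforce
  qed
  have "open {t. good t}"
    unfolding open_dist
  proof (intro ballI)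
    fix t assume "t \<in> {t. good t}"
    then obtain e K where e: "e > 0" "\<And>y j. y \<ge> 0 \<Longrightarrow> dist t y < e \<Longrightarrow> \<bar>v y j\<bar> \<le> K"
      unfolding good_def by blast
    show "\<exists>e>0. \<forall>y. dist y t < e \<longrightarrow> y \<in> {t. good t}"
    proof (intro exI conjI allI impI)
      show "e / 2 > 0" using e by simp
      fix y assume y: "dist y t < e / 2"
      have "dist t z < e" if "dist y z < e / 2" for z
        using y that dist_triangle_half_l[of t y e z] by (simp add: dist_commute)
      then have "\<forall>z\<ge>0. dist y z < e / 2 \<longrightarrow> (\<forall>j. \<bar>v z j\<bar> \<le> K)" using e(2) by blast
      then show "y \<in> {t. good t}" unfolding good_def using \<open>e / 2 > 0\<close> by blast
    qed
  qed
  \<comment> \<open>\<open>S\<close> is the set of bad times. By pointwise boundedness it is covered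
    by the sets \<open>F n\<close>, which are closed because each component is continuous.\<close>
  define S where "S = {0..} \<inter> - {t. good t}"
  have S: "closed S"
    unfolding S_def using \<open>open {t. good t}\<close> by (intro closed_Int closed_atLeast) (simp add: closed_Compl)
  define F where "F n = {t \<in> S. \<forall>j. \<bar>v t j\<bar> \<le> real n}" for n
  have Fcl: "closed (F n)" for n
  proof -
    have "F n = S \<inter> (\<Inter>j. S \<inter> (\<lambda>t. \<bar>v t j\<bar>) -` {..real n})" by (auto simp: F_def)
    moreover have "closed (S \<inter> (\<lambda>t. \<bar>v t j\<bar>) -` {..real n})" for j
      by (intro continuous_closed_preimage continuous_intros S
          continuous_on_subset[OF lattice_solution_continuous[OF v]])
        (auto simp: S_def)
    ultimately show ?thesis using S by (simp only: closed_INT closed_Int simp_thms ball_simps)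
  qed
  have "S = {}"
  proof (rule ccontr)
    assume ne: "S \<noteq> {}"
    have cov: "\<exists>n. t \<in> F n" if t: "t \<in> S" for t
    proof -
      obtain K where "\<And>j. \<bar>v t j\<bar> \<le> K"
        using bd[of t] t by (auto simp: bounded_iff S_def)
      moreover obtain n where "K \<le> real n" using real_arch_simple by blast
      ultimately have "t \<in> F n" using that by (auto simp: F_def intro: order_trans)
      then show ?thesis ..
    qed
    \<comment> \<open>If every relatively open set \<open>S - F n\<close> were dense in
      \<open>S\<close>, Baire's theorem would make their intersection dense, but it is
      empty.\<close>
    have "\<exists>n. \<not> S \<subseteq> closure (S - F n)"
    proof (rule ccontr)
      assume "\<not> ?thesis"
      then have "S \<subseteq> closure (\<Inter>(range (\<lambda>n. S - F n)))"
      proof (intro Baire[OF S])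
        fix T assume "T \<in> range (\<lambda>n. S - F n)"
        then obtain n where T: "T = S - F n" by blast
        then have "T = S \<inter> - F n" by blast
        then show "openin (top_of_set S) T \<and> S \<subseteq> closure T"
          using Fcl[of n] \<open>\<not> (\<exists>n. \<not> S \<subseteq> closure (S - F n))\<close> T
          by (metis openin_open_Int open_Compl)
      qed simp
      moreover have "\<Inter>(range (\<lambda>n. S - F n)) = {}" using cov by blast
      ultimately show False using ne by (metis closure_empty subset_empty)
    qed
    then obtain n t0 where t0: "t0 \<in> S" "t0 \<notin> closure (S - F n)" by blast
    then obtain e where e: "e > 0" "\<And>y. y \<in> S - F n \<Longrightarrow> e \<le> dist y t0"
      by (auto simp: closure_approachable not_less)
    \<comment> \<open>Within \<open>e\<close> of \<open>t0\<close> every bad time lies in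
      \<open>F n\<close>; the second term makes the short-time estimate applicable on segments of
      length up to \<open>r\<close>.\<close>
    define r where "r = min e (1 / (2 * C))"
    have r: "r > 0" "r \<le> e" using e(1) C by (auto simp: r_def)
    have Cr: "C * r \<le> 1 / 2"
    proof -
      have "C * r \<le> C * (1 / (2 * C))" using C by (intro mult_left_mono) (auto simp: r_def)
      then show ?thesis using C by simp
    qed
    have nb: "\<bar>v t j\<bar> \<le> 2 * real n + 1" if t: "t \<ge> 0" "dist t0 t < r" for t j
    proof (cases "t \<in> S")
      case True
      then have "t \<in> F n" using e(2)[of t] t(2) r(2) by (force simp: dist_commute)
      then have "\<bar>v t j\<bar> \<le> real n" by (simp add: F_def)
      then show ?thesis by simp
    next
      case False
      \<comment> \<open>\<open>al\<close> is the bad time next to \<open>t\<close>. The short-time estimate, read backwards from \<open>t\<close>, bounds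
        the solution between \<open>al\<close> and \<open>t\<close>; only then can it be read forwards from \<open>al\<close>.\<close>
      define Z where "Z = S \<inter> closed_segment t0 t"
      have "compact Z" unfolding Z_def using S by (intro closed_Int_compact) auto
      moreover have "Z \<noteq> {}" using t0(1) by (auto simp: Z_def)
      ultimately obtain al where al: "al \<in> Z" "\<And>y. y \<in> Z \<Longrightarrow> dist t al \<le> dist t y"
        using distance_attains_inf[of Z t] by (metis compact_imp_closed)
      have al0: "al \<in> S" "al \<ge> 0" and alseg: "al \<in> closed_segment t0 t"
        using al(1) by (auto simp: Z_def S_def)
      have seg: "closed_segment t al \<subseteq> closed_segment t0 t" using alseg by (simp add: subset_closed_segment)
      have dal: "dist t0 al < r" "\<bar>al - t\<bar> < r"
        using alseg t(2) by (auto simp: closed_segment_eq_real_ivl dist_real_def split: if_splits)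
      have nn: "x \<ge> 0" if "x \<in> closed_segment t al" for x
        using that t(1) al0(2) by (auto simp: closed_segment_eq_real_ivl split: if_splits)
      obtain K0 where K0: "\<And>j. \<bar>v t j\<bar> \<le> K0"
        using bd[OF t(1)] by (auto simp: bounded_iff)
      have aln: "\<bar>v al j\<bar> \<le> real n" for j
      proof -
        have "al \<in> F n" using e(2)[of al] dal(1) r(2) al0(1) by (force simp: dist_commute)
        then show ?thesis by (simp add: F_def)
      qed
      \<comment> \<open>Since \<open>al\<close> is the nearest bad time, the segment from
        \<open>t\<close> to \<open>x\<close> is good and has some bound \<open>K\<close>. That
        \<open>K\<close> may blow up as \<open>x\<close> approaches \<open>al\<close>; the
        short-time estimate replaces it by one that depends on \<open>K0\<close> alone.\<close>
      have bound: "\<bar>v x j\<bar> \<le> 2 * K0 + 1" if x: "x \<in> closed_segment t al" "x \<noteq> al" for x j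
      proof -
        have sub: "closed_segment t x \<subseteq> closed_segment t al" using x by (simp add: subset_closed_segment)
        have "good y" if y: "y \<in> closed_segment t x" for y
        proof (rule ccontr)
          assume "\<not> good y"
          then have "y \<in> Z" using y sub seg nn by (auto simp: Z_def S_def)
          then have "dist t al \<le> dist t y" by (rule al(2))
          then show False
            using y x by (auto simp: closed_segment_eq_real_ivl dist_real_def split: if_splits)
        qed
        moreover have "closed_segment t x \<subseteq> {0..}" using sub nn by auto
        ultimately obtain K where K: "\<And>y j. y \<in> closed_segment t x \<Longrightarrow> \<bar>v y j\<bar> \<le> K"
          using good_bounded[OF compact_segment, of t x] by metis
        have "\<bar>x - t\<bar> \<le> r"
          using x dal(2) by (auto simp: closed_segment_eq_real_ivl split: if_splits)
        then have "C * \<bar>x - t\<bar> \<le> 1 / 2"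
          using Cr C by (meson mult_left_mono order_trans zero_le_one)
        then show ?thesis
          unfolding C_def
          by (intro lattice_solution_short_time[OF k d v t(1) nn[OF x(1)] _ K K0]) auto
      qed
      have "C * \<bar>t - al\<bar> \<le> 1 / 2"
        using Cr C dal(2) mult_left_mono[of "\<bar>t - al\<bar>" r C] by linarith
      moreover have "\<bar>v x j\<bar> \<le> max (real n) (2 * K0 + 1)" if "x \<in> closed_segment al t" for x j
        using that bound[of x j] aln[of j] by (cases "x = al") (auto simp: closed_segment_commute)
      ultimately show ?thesis
        unfolding C_def
        by (intro lattice_solution_short_time[OF k d v al0(2) t(1) _ _ aln]) auto
    qed
    \<comment> \<open>The bound \<open>2 * real n + 1\<close> does not depend on \<open>t\<close>,
      so it is a uniform bound around the bad time \<open>t0\<close>, a contradiction.\<close>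
    then have "good t0" unfolding good_def using r(1) by blast
    then show False using t0(1) by (simp add: S_def)
  qed
  then show ?thesis by (intro good_bounded) (auto simp: S_def)
qed

section \<open>Maximum principle and stability\<close>

text \<open>If \<open>h\<close> ended above \<open>m\<close>, there would be a last time
  \<open>r\<close> with \<open>h r = m\<close>. From then on \<open>h\<close> is at least
  \<open>m\<close>, so the integrand is nonpositive and \<open>h\<close> cannot have increased. The
  integral form avoids differentiating \<open>h\<close>.\<close>

lemma barrier:
  fixes h f :: "real \<Rightarrow> real"
  assumes h: "continuous_on {s..t} h" and "s \<le> t" "h s \<le> m"
    and f: "\<And>r. r \<in> {s..t} \<Longrightarrow> (f has_integral (h t - h r)) {r..t}"
    and neg: "\<And>x. x \<in> {s..t} \<Longrightarrow> h x \<ge> m \<Longrightarrow> f x \<le> 0"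
  shows "h t \<le> m"
proof (rule ccontr)
  assume t: "\<not> h t \<le> m"
  define Z where "Z = {x \<in> {s..t}. h x = m}"
  have ivt: "\<exists>y\<in>Z. x \<le> y" if x: "x \<in> {s..t}" "h x \<le> m" for x
  proof -
    have "\<exists>y\<ge>x. y \<le> t \<and> h y = m"
      by (rule IVT') (use x t in \<open>auto intro: continuous_on_subset[OF h]\<close>)
    then obtain y where "x \<le> y" "y \<le> t" "h y = m" by blast
    then show ?thesis using x by (intro bexI[of _ y]) (simp_all add: Z_def)
  qed
  have "Z \<noteq> {}" using ivt[of s] assms(2,3) by auto
  moreover have "compact Z"
  proof -
    have "Z = {s..t} \<inter> h -` {m}" by (auto simp: Z_def)
    then have "closed Z" by (simp add: continuous_closed_preimage[OF h])
    moreover have "Z = {s..t} \<inter> Z" by (auto simp: Z_def)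
    ultimately show ?thesis by (metis compact_Int_closed compact_Icc)
  qed
  ultimately obtain r where r: "r \<in> Z" "\<And>x. x \<in> Z \<Longrightarrow> x \<le> r"
    using compact_attains_sup by metis
  have rst: "r \<in> {s..t}" "h r = m" using r(1) by (auto simp: Z_def)
  have ge: "h x \<ge> m" if x: "x \<in> {r..t}" for x
  proof (rule ccontr)
    assume lt: "\<not> h x \<ge> m"
    obtain y where "y \<in> Z" "x \<le> y" using ivt[of x] lt x rst by force
    then have "x = r" using r(2)[of y] x by simp
    then show False using lt rst by simp
  qed
  have "h t - h r \<le> 0"
    by (rule has_integral_le[OF f[OF rst(1)] has_integral_0]) (use ge neg rst in auto)
  then show False using t rst by simp
qed

text \<open>A bootstrap: the weak bound \<open>m + \<eta>\<close> on the interval improves to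
  \<open>m\<close> at its end. Closeness below \<open>\<gamma>\<close> keeps solution and wave on
  the same side of \<open>a\<close>, so the jumps cancel. The linear damping of \<open>g_MK\<close>
  supplies the slack that absorbs \<open>d * (k + 1) * \<eta>\<close>.\<close>

lemma lattice_solution_near_wave_step:
  assumes k: "k > 1" and d: "d > 0" and v: "lattice_solution d k a v"
    and u: "\<And>i. 0 = lattice_rhs d k a u i" and gap: "\<And>i. \<gamma> \<le> \<bar>u i - a\<bar>"
    and st: "0 \<le> s" "s \<le> t"
    and \<eta>: "d * (k + 1) * \<eta> \<le> m" "m + \<eta> < \<gamma>"
    and start: "\<And>i. \<bar>v s i - u i\<bar> \<le> m"
    and near: "\<And>x i. x \<in> {s..t} \<Longrightarrow> \<bar>v x i - u i\<bar> \<le> m + \<eta>"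
  shows "\<bar>v t i - u i\<bar> \<le> m"
proof -
  define f where "f x = lattice_rhs d k a (v x) i" for x
  have f: "(f has_integral (v t i - v r i)) {r..t}" if "r \<in> {s..t}" for r
    unfolding f_def using lattice_solution_has_integral[OF v] that st by simp
  have cont: "continuous_on {s..t} (\<lambda>x. v x i)"
    by (rule continuous_on_subset[OF lattice_solution_continuous[OF v]]) (use st in auto)
  have lin: "\<bar>f x + (d * (k + 1) + 1) * (v x i - u i)\<bar> \<le> (d * (k + 1) + 1) * m"
    if x: "x \<in> {s..t}" for x
  proof -
    let ?w = "\<lambda>i. v x i - u i"
    have "v x i < a \<longleftrightarrow> u i < a" using near[OF x, of i] gap[of i] \<eta>(2) by linarith
    then have "f x - lattice_rhs d k a u i + (d * (k + 1) + 1) * ?w i =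
        d * (k * ?w (i + 1) + ?w (i - 1))"
      by (auto simp: f_def lattice_rhs_def g_MK_def algebra_simps)
    then have "f x + (d * (k + 1) + 1) * ?w i = d * (k * ?w (i + 1) + ?w (i - 1))"
      using u[of i] by simp
    also have "\<bar>\<dots>\<bar> = d * \<bar>k * ?w (i + 1) + ?w (i - 1)\<bar>" using d by (simp add: abs_mult)
    also have "\<dots> \<le> d * (k * \<bar>?w (i + 1)\<bar> + \<bar>?w (i - 1)\<bar>)"
      using d k abs_triangle_ineq[of "k * ?w (i + 1)" "?w (i - 1)"]
      by (intro mult_left_mono) (auto simp: abs_mult)
    also have "\<dots> \<le> d * (k * (m + \<eta>) + (m + \<eta>))"
      using near[OF x] k d by (intro mult_left_mono add_mono) auto
    also have "\<dots> = d * (k + 1) * m + d * (k + 1) * \<eta>" by (simp add: algebra_simps)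
    also have "\<dots> \<le> (d * (k + 1) + 1) * m" using \<eta>(1) by (simp add: algebra_simps)
    finally show ?thesis .
  qed
  have c: "d * (k + 1) + 1 > 0" using k d by (simp add: add_pos_pos)
  have "v t i - u i \<le> m"
  proof (rule barrier[where f = f and h = "\<lambda>x. v x i - u i" and s = s])
    show "f x \<le> 0" if "x \<in> {s..t}" "m \<le> v x i - u i" for x
      using lin[OF that(1)] mult_left_mono[OF that(2), of "d * (k + 1) + 1"] c by linarith
  qed (use f start[of i] st in \<open>auto intro!: continuous_intros cont\<close>)
  moreover have "- (v t i - u i) \<le> m"
  proof (rule barrier[where f = "\<lambda>x. - f x" and h = "\<lambda>x. - (v x i - u i)" and s = s])
    show "- f x \<le> 0" if "x \<in> {s..t}" "m \<le> - (v x i - u i)" for x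
      using lin[OF that(1)] mult_left_mono[OF that(2), of "d * (k + 1) + 1"] c
      by (simp only: mult_minus_right) linarith
    show "((\<lambda>x. - f x) has_integral - (v t i - u i) - - (v r i - u i)) {r..t}" if "r \<in> {s..t}" for r
      using has_integral_neg[OF f[OF that]] by simp
  qed (use start[of i] st in \<open>auto intro!: continuous_intros cont\<close>)
  ultimately show ?thesis by linarith
qed

text \<open>The bound \<open>m\<close> serves as the required initial closeness and is then
  preserved for all times, by repeating time steps of a fixed length \<open>L\<close>.\<close>

lemma pinned_monotone_wave_stable:
  assumes k: "k > 1" and d: "d > 0" and w: "pinned_monotone_wave d k a u"
    and \<gamma>: "\<gamma> > 0" and gap: "\<And>i. \<gamma> \<le> \<bar>u i - a\<bar>"
  shows "wave_stable d k a u"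
  unfolding wave_stable_def
proof (intro allI impI)
  fix \<epsilon> :: real assume \<epsilon>: "\<epsilon> > 0"
  \<comment> \<open>\<open>m\<close> lies strictly below \<open>\<epsilon>\<close>, and
    \<open>\<eta>\<close> is the slack of the bootstrap. \<open>B\<close> bounds the speed of a
    solution while its values are at most \<open>2 * (m + 1) + 1\<close>, and within time
    \<open>L\<close> such a solution moves by at most \<open>\<eta>\<close>.\<close>
  define m where "m = min \<epsilon> \<gamma> / 2"
  define \<eta> where "\<eta> = min (\<gamma> / 4) (m / (d * (k + 1)))"
  define C where "C = 2 * d * (k + 1) + 1"
  define B where "B = C * (2 * (m + 1) + 1) + 1"
  define L where "L = min (1 / (2 * C)) (\<eta> / B)"
  have m: "m > 0" "m < \<epsilon>" "m \<le> \<gamma> / 2" using \<epsilon> \<gamma> by (auto simp: m_def)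
  have dk: "d * (k + 1) > 0" using k d by simp
  have \<eta>: "\<eta> > 0" "d * (k + 1) * \<eta> \<le> m" "m + \<eta> < \<gamma>"
  proof -
    show "\<eta> > 0" using m \<gamma> dk by (simp add: \<eta>_def)
    have "\<eta> \<le> m / (d * (k + 1))" by (simp add: \<eta>_def)
    then show "d * (k + 1) * \<eta> \<le> m" using dk by (simp add: pos_le_divide_eq mult.commute)
    have "\<eta> \<le> \<gamma> / 4" unfolding \<eta>_def by (rule min.cobounded1)
    then show "m + \<eta> < \<gamma>" using m(3) \<gamma> by linarith
  qed
  have C: "C \<ge> 1" using k d by (simp add: C_def)
  have "C * (2 * (m + 1) + 1) \<ge> 0" using C m by simp
  then have B: "B > 0" by (simp add: B_def)
  have L: "L > 0" "C * L \<le> 1 / 2" "B * L \<le> \<eta>"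
  proof -
    show "L > 0" using C B \<eta> by (simp add: L_def)
    have "L \<le> 1 / (2 * C)" "L \<le> \<eta> / B" by (auto simp: L_def)
    then show "C * L \<le> 1 / 2" "B * L \<le> \<eta>" using C B by (simp_all add: field_simps)
  qed
  note rng = pinned_monotone_wave_range[OF w]
  have u: "0 = lattice_rhs d k a u i" for i using w by (simp add: pinned_monotone_wave_def)
  show "\<exists>\<delta>>0. \<forall>v. lattice_solution d k a v \<longrightarrow> (\<forall>t\<ge>0. bounded (range (v t))) \<longrightarrow>
      (SUP i. \<bar>v 0 i - u i\<bar>) < \<delta> \<longrightarrow> (\<forall>t\<ge>0. (SUP i. \<bar>v t i - u i\<bar>) < \<epsilon>)"
  proof (intro exI conjI allI impI)
    show "m > 0" by (rule m)
    fix v and t :: real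
    assume v: "lattice_solution d k a v" and bd: "\<forall>t\<ge>0. bounded (range (v t))"
      and start: "(SUP i. \<bar>v 0 i - u i\<bar>) < m" and t: "t \<ge> 0"
    have start: "\<bar>v 0 i - u i\<bar> \<le> m" for i
    proof -
      obtain K where K: "\<And>j. \<bar>v 0 j\<bar> \<le> K" using bd by (auto simp: bounded_iff)
      have "\<bar>v 0 j - u j\<bar> \<le> K + 1" for j using K[of j] rng[of j] by linarith
      then have "\<bar>v 0 i - u i\<bar> \<le> (SUP i. \<bar>v 0 i - u i\<bar>)"
        by (intro cSUP_upper bdd_aboveI2) auto
      then show ?thesis using start by linarith
    qed
    \<comment> \<open>The local bound \<open>K\<close> depends on the solution and on
      \<open>s\<close>, but it only makes the short-time estimate available. \<open>L\<close> is
      therefore the same in every step, and the induction below reaches every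
      \<open>t\<close>.\<close>
    have step: "\<bar>v y i - u i\<bar> \<le> m"
      if s: "s \<ge> 0" "\<And>i. \<bar>v s i - u i\<bar> \<le> m" and y: "y \<in> {s..s + L}" for s y i
    proof -
      obtain K where K: "\<And>x j. x \<in> {s..s + L} \<Longrightarrow> \<bar>v x j\<bar> \<le> K"
        using lattice_solution_locally_bounded[OF k d v, of "s + L"] bd s(1)
        by (metis atLeastAtMost_iff order_trans)
      have vs: "\<bar>v s j\<bar> \<le> m + 1" for j using s(2)[of j] rng[of j] by linarith
      have seg: "closed_segment s x \<subseteq> {s..s + L}" if "x \<in> {s..s + L}" for x
        using that by (simp add: closed_segment_eq_real_ivl)
      have short: "\<bar>v x j\<bar> \<le> 2 * (m + 1) + 1" if x: "x \<in> {s..s + L}" for x j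
      proof (rule lattice_solution_short_time[OF k d v, of s "s + L" K])
        show "x \<in> closed_segment s (s + L)" using x by (simp add: closed_segment_eq_real_ivl)
      qed (use s L K vs seg[of "s + L"] in \<open>auto simp: C_def subset_iff\<close>)
      have near: "\<bar>v x j - u j\<bar> \<le> m + \<eta>" if x: "x \<in> {s..s + L}" for x j
      proof -
        have "\<bar>v x j - v s j\<bar> \<le> B * \<bar>x - s\<bar>"
          unfolding B_def C_def
          by (rule lattice_solution_increment[OF k d v]) (use s x seg[OF x] short in auto)
        also have "\<dots> \<le> B * L" using x B by (intro mult_left_mono) auto
        finally show ?thesis using s(2)[of j] L(3) by linarith
      qed
      show ?thesis
        by (rule lattice_solution_near_wave_step[OF k d v u gap s(1) _ \<eta>(2,3) s(2)])
          (use y near in auto)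
    qed
    have "\<bar>v y i - u i\<bar> \<le> m" if "y \<in> {0..real n * L}" for n y i
      using that
    proof (induction n arbitrary: y i)
      case 0
      then show ?case using start by simp
    next
      case (Suc n)
      show ?case
      proof (cases "y \<le> real n * L")
        case True
        then show ?thesis using Suc by simp
      next
        case False
        show ?thesis
          by (rule step[of "real n * L"])
            (use Suc False L in \<open>auto simp: algebra_simps intro!: Suc.IH\<close>)
      qed
    qed
    moreover obtain n where "t / L \<le> real n" using real_arch_simple by blast
    then have "t \<in> {0..real n * L}" using t L by (simp add: field_simps)
    ultimately have "(SUP i. \<bar>v t i - u i\<bar>) \<le> m" by (intro cSUP_least) auto
    then show "(SUP i. \<bar>v t i - u i\<bar>) < \<epsilon>" using m by simp
  qed
qed

theorem theorem1p1:
  fixes k d a :: real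
  assumes "k > 1" and "d > 0" and "0 < a" and "a < 1"
  shows "((\<exists>u. pinned_monotone_wave d k a u) \<longleftrightarrow> a_minus d k < a \<and> a \<le> a_plus d k) \<and>
         (\<forall>u. pinned_monotone_wave d k a u \<longrightarrow> a \<noteq> a_plus d k \<longrightarrow> wave_stable d k a u)"
proof (intro conjI allI impI)
  show "(\<exists>u. pinned_monotone_wave d k a u) \<longleftrightarrow> a_minus d k < a \<and> a \<le> a_plus d k"
    by (rule pinned_monotone_wave_exists_iff[OF assms])
  fix u assume u: "pinned_monotone_wave d k a u" and a: "a \<noteq> a_plus d k"
  obtain n where n: "\<And>i. u i < a \<longleftrightarrow> i < n"
    using pinned_monotone_wave_threshold[OF u assms(3,4)] by blast
  have mono: "mono u" using u by (simp add: pinned_monotone_wave_def)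
  \<comment> \<open>The choice of \<open>n\<close> alone gives only \<open>a \<le> u n\<close>;
    equality is ruled out because \<open>u n = a_plus d k\<close> differs from \<open>a\<close>. By
    monotonicity these two neighbours determine the distance of the wave from
    \<open>a\<close>.\<close>
  have lo: "u (n - 1) < a" and hi: "u n > a"
    using n[of "n - 1"] n[of n] a pinned_monotone_wave_at_threshold(1)[OF assms(1,2) u n] by auto
  show "wave_stable d k a u"
  proof (rule pinned_monotone_wave_stable[OF assms(1,2) u])
    show "min (a - u (n - 1)) (u n - a) > 0" using lo hi by simp
    show "min (a - u (n - 1)) (u n - a) \<le> \<bar>u i - a\<bar>" for i
    proof (cases "i < n")
      case True
      then show ?thesis using monoD[OF mono, of i "n - 1"] by linarith
    next
      case False
      then show ?thesis using monoD[OF mono, of n i] by linarith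
    qed
  qed
qed

end
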